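(* Let $r\geq3$ be an integer and let $\mathbf{N}_r$ be the Fraïssé limit of the class of finite integral metric spaces with no unit $(r-1)$-simplex. Then $\mathrm{Isom}(\mathbf{N}_r)$ is dissociated.
   Context: An integral metric space is a metric space $(X,d)$ with $d(X\times X)\subseteq\mathbb{N}=\{0,1,2,\dots\}$, viewed as a relational structure with one binary relation $R_n=\{(x,y):d(x,y)=n\}$ for each $n\geq0$. A unit $(r-1)$-simplex in $(X,d)$ is a subset of $X$ consisting of $r$ points that lie mutually at distance $1$. The class of finite integral metric spaces with no unit $(r-1)$-simplex is a Fraïssé class; its Fraïssé limit $\mathbf{N}_r$ is the unique (up to isometry) countable integral metric space with no unit $(r-1)$-simplex that contains an isometric copy of every finite one and is metrically homogeneous (every surjective isometry between finite subsets extends to a surjective isometry of the whole space). Let $\Omega$ be the countably infinite underlying set of $\mathbf{N}_r$. $G=\mathrm{Isom}(\mathbf{N}_r)$, the group of surjective isometries, is a closed subgroup of $\mathrm{Sym}(\Omega)$ with the topology of pointwise convergence ($\Omega$ discrete). For $A\subseteq\Omega$, $G_A$ is the pointwise stabilizer of $A$. A unitary representation of $G$ on a Hilbert space $\mathcal{H}$ is a homomorphism $\pi:G\to\mathcal{U}(\mathcal{H})$ with $g\mapsto\pi(g)\xi$ continuous for all $\xi$. It is dissociated if $p_Ap_B=p_{A\cap B}$ for all finite $A,B\subseteq\Omega$, where $p_A$ is the orthogonal projection onto $\mathcal{H}_A=\{\xi\in\mathcal{H}:\pi(g)\xi=\xi\text{ for all }g\in G_A\}$. $G$ is dissociated if all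 of its unitary representations are dissociated. *)

theory Defs
  imports "HOL-Analysis.Analysis" "HOL-Algebra.Bij"
begin

section \<open>Complex Hilbert spaces and unitary operators\<close>

text \<open>
  A complex inner product space carries its underlying real inner product
  \<^term>\<open>inner\<close> as the real part of the complex one. Hence norm, metric and topology
  are the usual ones, and positive definiteness is inherited from \<^class>\<open>real_inner\<close>.
  The complex inner product is linear in the first argument.
\<close>

class complex_inner = real_inner +
  fixes scaleC :: "complex \<Rightarrow> 'a \<Rightarrow> 'a"  (infixr "*\<^sub>C" 75)
    and cinner :: "'a \<Rightarrow> 'a \<Rightarrow> complex"
  assumes scaleC_add_right: "c *\<^sub>C (x + y) = c *\<^sub>C x + c *\<^sub>C y"
    and scaleC_add_left: "(b + c) *\<^sub>C x = b *\<^sub>C x + c *\<^sub>C x"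
    and scaleC_scaleC: "b *\<^sub>C c *\<^sub>C x = (b * c) *\<^sub>C x"
    and scaleC_of_real: "complex_of_real t *\<^sub>C x = t *\<^sub>R x"
    and cinner_commute: "cinner x y = cnj (cinner y x)"
    and cinner_add_left: "cinner (x + y) z = cinner x z + cinner y z"
    and cinner_scaleC_left: "cinner (c *\<^sub>C x) y = c * cinner x y"
    and inner_eq_Re_cinner: "inner x y = Re (cinner x y)"

class chilbert_space = complex_inner + complete_space

definition unitary_op :: "('h::complex_inner \<Rightarrow> 'h) \<Rightarrow> bool" where
  "unitary_op U \<longleftrightarrow>
     (\<forall>x y. U (x + y) = U x + U y) \<and>
     (\<forall>c x. U (c *\<^sub>C x) = c *\<^sub>C U x) \<and>
     (\<forall>x y. cinner (U x) (U y) = cinner x y) \<and>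
     surj U"

definition unitary_group :: "('h::complex_inner \<Rightarrow> 'h) monoid" where
  "unitary_group = \<lparr>carrier = {U. unitary_op U}, mult = (\<circ>), one = id\<rparr>"

text \<open>
  Only meaningful for closed subspaces \<open>S\<close> of a Hilbert space, where the
  described vector exists and is unique.
\<close>

definition orth_proj :: "'h::complex_inner set \<Rightarrow> 'h \<Rightarrow> 'h" where
  "orth_proj S x = (THE p. p \<in> S \<and> (\<forall>s\<in>S. cinner (x - p) s = 0))"


section \<open>Dissociated representations of permutation groups\<close>

text \<open>
  Permutation groups on \<open>\<Omega>\<close> are given as subgroups of \<^term>\<open>BijGroup \<Omega>\<close>, whose elements
  are bijections of \<open>\<Omega>\<close> that are extensional, i.e. \<^const>\<open>undefined\<close> outside \<open>\<Omega>\<close>.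
  So the topology of pointwise convergence is a product topology over \<open>\<Omega>\<close>.
\<close>

definition perm_topology :: "'a set \<Rightarrow> ('a \<Rightarrow> 'a) monoid \<Rightarrow> ('a \<Rightarrow> 'a) topology" where
  "perm_topology \<Omega> G =
     subtopology (product_topology (\<lambda>_. discrete_topology \<Omega>) \<Omega>) (carrier G)"

definition pointwise_stabilizer :: "('a \<Rightarrow> 'a) monoid \<Rightarrow> 'a set \<Rightarrow> ('a \<Rightarrow> 'a) set" where
  "pointwise_stabilizer G A = {g \<in> carrier G. \<forall>a\<in>A. g a = a}"

definition unitary_rep ::
  "'a set \<Rightarrow> ('a \<Rightarrow> 'a) monoid \<Rightarrow> (('a \<Rightarrow> 'a) \<Rightarrow> 'h::chilbert_space \<Rightarrow> 'h) \<Rightarrow> bool" where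
  "unitary_rep \<Omega> G \<pi> \<longleftrightarrow>
     \<pi> \<in> hom G unitary_group \<and>
     (\<forall>\<xi>. continuous_map (perm_topology \<Omega> G) euclidean (\<lambda>g. \<pi> g \<xi>))"

definition fixed_vectors ::
  "('a \<Rightarrow> 'a) monoid \<Rightarrow> (('a \<Rightarrow> 'a) \<Rightarrow> 'h::chilbert_space \<Rightarrow> 'h) \<Rightarrow> 'a set \<Rightarrow> 'h set" where
  "fixed_vectors G \<pi> A = {\<xi>. \<forall>g\<in>pointwise_stabilizer G A. \<pi> g \<xi> = \<xi>}"

definition dissociated_rep ::
  "'a set \<Rightarrow> ('a \<Rightarrow> 'a) monoid \<Rightarrow> (('a \<Rightarrow> 'a) \<Rightarrow> 'h::chilbert_space \<Rightarrow> 'h) \<Rightarrow> bool" where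
  "dissociated_rep \<Omega> G \<pi> \<longleftrightarrow>
     (\<forall>A B. finite A \<and> A \<subseteq> \<Omega> \<and> finite B \<and> B \<subseteq> \<Omega> \<longrightarrow>
        orth_proj (fixed_vectors G \<pi> A) \<circ> orth_proj (fixed_vectors G \<pi> B)
          = orth_proj (fixed_vectors G \<pi> (A \<inter> B)))"

text \<open>
  A definition cannot quantify over all Hilbert spaces, so the Hilbert space type is
  a parameter. A statement about \<open>dissociated_group TYPE('h)\<close> with \<open>'h\<close> a type
  variable of class \<^class>\<open>chilbert_space\<close> is about all of them.
\<close>

definition dissociated_group ::
  "'h::chilbert_space itself \<Rightarrow> 'a set \<Rightarrow> ('a \<Rightarrow> 'a) monoid \<Rightarrow> bool" where
  "dissociated_group _ \<Omega> G \<longleftrightarrow>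
     (\<forall>\<pi> :: ('a \<Rightarrow> 'a) \<Rightarrow> 'h \<Rightarrow> 'h. unitary_rep \<Omega> G \<pi> \<longrightarrow> dissociated_rep \<Omega> G \<pi>)"


section \<open>Integral metric spaces without unit simplices\<close>

definition integral_metric_space :: "'a set \<Rightarrow> ('a \<Rightarrow> 'a \<Rightarrow> real) \<Rightarrow> bool" where
  "integral_metric_space M d \<longleftrightarrow> Metric_space M d \<and> (\<forall>x\<in>M. \<forall>y\<in>M. d x y \<in> \<nat>)"

text \<open>A unit \<open>k\<close>-simplex has \<open>k + 1\<close> vertices.\<close>

definition unit_simplex :: "'a set \<Rightarrow> ('a \<Rightarrow> 'a \<Rightarrow> real) \<Rightarrow> nat \<Rightarrow> 'a set \<Rightarrow> bool" where
  "unit_simplex M d k S \<longleftrightarrow>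
     S \<subseteq> M \<and> finite S \<and> card S = k + 1 \<and> pairwise (\<lambda>x y. d x y = 1) S"

text \<open>Integral metric spaces with no unit \<open>(r - 1)\<close>-simplex, for \<open>r \<ge> 1\<close>.\<close>

definition simplex_free_space :: "nat \<Rightarrow> 'a set \<Rightarrow> ('a \<Rightarrow> 'a \<Rightarrow> real) \<Rightarrow> bool" where
  "simplex_free_space r M d \<longleftrightarrow>
     integral_metric_space M d \<and> (\<nexists>S. unit_simplex M d (r - 1) S)"

definition surj_isometry ::
  "'a set \<Rightarrow> ('a \<Rightarrow> 'a \<Rightarrow> real) \<Rightarrow> 'b set \<Rightarrow> ('b \<Rightarrow> 'b \<Rightarrow> real) \<Rightarrow> ('a \<Rightarrow> 'b) \<Rightarrow> bool" where
  "surj_isometry M d N e f \<longleftrightarrow>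
     f ` M = N \<and> (\<forall>x\<in>M. \<forall>y\<in>M. e (f x) (f y) = d x y)"

definition isom_group :: "'a set \<Rightarrow> ('a \<Rightarrow> 'a \<Rightarrow> real) \<Rightarrow> ('a \<Rightarrow> 'a) monoid" where
  "isom_group M d =
     (BijGroup M)\<lparr>carrier := {g \<in> Bij M. surj_isometry M d M d g}\<rparr>"

definition metrically_homogeneous :: "'a set \<Rightarrow> ('a \<Rightarrow> 'a \<Rightarrow> real) \<Rightarrow> bool" where
  "metrically_homogeneous M d \<longleftrightarrow>
     (\<forall>A B f. finite A \<and> A \<subseteq> M \<and> finite B \<and> B \<subseteq> M \<and> surj_isometry A d B d f \<longrightarrow>
        (\<exists>g\<in>carrier (isom_group M d). \<forall>a\<in>A. g a = f a))"

text \<open>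
  The limit is unique up to isometry, so it is introduced by its characterization.
  Every finite space is isometric to one whose points are natural numbers, so
  universality only mentions those.
\<close>

definition is_simplex_free_limit :: "nat \<Rightarrow> 'a set \<Rightarrow> ('a \<Rightarrow> 'a \<Rightarrow> real) \<Rightarrow> bool" where
  "is_simplex_free_limit r \<Omega> d \<longleftrightarrow>
     countable \<Omega> \<and>
     simplex_free_space r \<Omega> d \<and>
     (\<forall>(F :: nat set) e. finite F \<and> simplex_free_space r F e \<longrightarrow>
        (\<exists>N f. N \<subseteq> \<Omega> \<and> surj_isometry F e N d f)) \<and>
     metrically_homogeneous \<Omega> d"

end

theory Submission
  imports Defs
begin

text \<open>
  Write \<open>H_A\<close> for the vectors fixed by the pointwise stabilizer \<open>G_A\<close>, and \<open>p_A\<close> for the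
  orthogonal projection onto \<open>H_A\<close>. The task is to show \<open>p_A p_B x \<in> H_(A \<inter> B)\<close>:
  the residual \<open>x - p_A p_B x\<close> is then orthogonal to \<open>H_(A \<inter> B)\<close>, because this space is
  contained in both \<open>H_A\<close> and \<open>H_B\<close>.

  Let \<open>v = p_B x\<close> and \<open>w = p_A v\<close>. By the mean ergodic theorem in the form of Alaoglu and
  Birkhoff (\<open>invariant_in_orbit_hull\<close>), \<open>w\<close> is a limit of convex combinations of vectors
  \<open>g v\<close> with \<open>g \<in> G_A\<close>. Each \<open>g v\<close> lies in \<open>H_(g B)\<close>, and \<open>g B\<close> meets \<open>A\<close> in
  \<open>A \<inter> B\<close> only. So \<open>w\<close> lies in \<open>H_A\<close> and is at the same time approximated by vectors of
  spaces \<open>H_F\<close> with \<open>F\<close> finite and disjoint from \<open>A - B\<close>. The points of \<open>A - B\<close> can therefore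
  be removed from the support of \<open>w\<close> one after the other, by the following principle
  (\<open>stab_move_fixes\<close>, \<open>forget_points\<close>): if \<open>v \<in> H_(D \<union> {b})\<close> is a limit of vectors of
  spaces \<open>H_F\<close> with \<open>b \<notin> F\<close>, then \<open>v \<in> H_D\<close>.

  For the principle, the vector \<open>h v\<close> with \<open>h \<in> G_D\<close> depends only on the position \<open>h b\<close>.
  Suppose first that \<open>d b (h b) = 2\<close>. Any finite \<open>F\<close> with \<open>b \<notin> F\<close> allows a twin \<open>z\<close> of
  \<open>b\<close>: a point at distance \<open>2\<close> from \<open>b\<close> and at the same distances as \<open>b\<close> from all points of
  \<open>F \<union> D\<close>. Distance \<open>2\<close> never violates a triangle inequality, since all other distances
  are at least \<open>1\<close>, and it creates no unit simplex. An isometry fixing \<open>F \<union> D\<close> carries \<open>b\<close> to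
  \<open>z\<close> and almost fixes \<open>v\<close>, and \<open>z\<close> can be moved to \<open>h b\<close> over \<open>D \<union> {b}\<close>. Since the
  approximation by \<open>H_F\<close> can be made arbitrarily good, \<open>h v = v\<close> (\<open>twin_move_fixes\<close>).
  An arbitrary position \<open>h b\<close> is reached from \<open>b\<close> by finitely many moves of length \<open>2\<close>
  through points with the same distances to \<open>D\<close>: the first move lowers the distance
  \<open>n \<ge> 3\<close> to \<open>n - 1\<close>, and the distance \<open>1\<close> is covered by two moves.
\<close>

section \<open>Projections onto invariant vectors\<close>

text \<open>
  The sets of points of \<open>K\<close> whose norm is nearly minimal are closed and nested, and by the
  parallelogram law their diameters tend to \<open>0\<close>, so completeness yields a common point.
\<close>

lemma closed_convex_minimal_norm:
  fixes K :: "'h::{real_inner,complete_space} set"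
  assumes "closed K" "convex K" "K \<noteq> {}"
  shows "\<exists>!p. p \<in> K \<and> (\<forall>y\<in>K. norm p \<le> norm y)"
proof -
  define m where "m = (INF y\<in>K. (norm y)\<^sup>2)"
  have bdd: "bdd_below ((\<lambda>y. (norm y)\<^sup>2) ` K)"
    by (rule bdd_belowI2[of _ 0]) simp
  have m_le: "m \<le> (norm y)\<^sup>2" if "y \<in> K" for y
    unfolding m_def using that bdd by (rule cINF_lower[rotated])
  \<comment> \<open>The parallelogram law, with the midpoint of \<open>x\<close> and \<open>y\<close> in \<open>K\<close>.\<close>
  have dist_le: "(dist x y)\<^sup>2 \<le> 2 * ((norm x)\<^sup>2 - m) + 2 * ((norm y)\<^sup>2 - m)"
    if "x \<in> K" "y \<in> K" for x y
  proof -
    have "(1/2) *\<^sub>R x + (1/2) *\<^sub>R y \<in> K"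
      using that \<open>convex K\<close> by (simp add: convexD)
    then have "m \<le> (norm ((1/2) *\<^sub>R (x + y)))\<^sup>2"
      using m_le by (simp add: scaleR_add_right)
    then have "4 * m \<le> (norm (x + y))\<^sup>2"
      by (simp add: power_divide)
    moreover have "(norm (x + y))\<^sup>2 + (norm (x - y))\<^sup>2 = 2 * (norm x)\<^sup>2 + 2 * (norm y)\<^sup>2"
      by (simp add: power2_norm_eq_inner inner_diff inner_add)
    ultimately show ?thesis
      by (simp add: dist_norm)
  qed
  define S where "S n = {y \<in> K. (norm y)\<^sup>2 \<le> m + 1 / Suc n}" for n
  obtain p where p: "\<And>n. p \<in> S n"
  proof (rule decreasing_closed_nest[of S])
    fix n
    have "closed {y. (norm y)\<^sup>2 \<le> m + 1 / Suc n}"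
      by (intro closed_Collect_le continuous_intros)
    then show "closed (S n)"
      unfolding S_def Collect_conj_eq using \<open>closed K\<close> by (metis Collect_mem_eq closed_Int)
    have "\<exists>y\<in>K. (norm y)\<^sup>2 < m + 1 / Suc n"
      using cINF_less_iff[OF \<open>K \<noteq> {}\<close> bdd, of "m + 1 / Suc n"] by (simp add: m_def)
    then show "S n \<noteq> {}"
      by (force simp: S_def)
  next
    fix i n :: nat
    assume "i \<le> n"
    then have "1 / real (Suc n) \<le> 1 / Suc i"
      by (simp add: frac_le)
    then show "S n \<subseteq> S i"
      by (auto simp: S_def)
  next
    fix e :: real
    assume "e > 0"
    then obtain n where n: "1 / Suc n < e\<^sup>2 / 4"
      using nat_approx_posE[of "e\<^sup>2 / 4"] by (metis zero_less_divide_iff zero_less_numeral zero_less_power)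
    have "dist x y < e" if "x \<in> S n" "y \<in> S n" for x y
    proof -
      have "(dist x y)\<^sup>2 < e\<^sup>2"
        using dist_le[of x y] that n by (simp add: S_def)
      then show ?thesis
        using \<open>e > 0\<close> power2_less_imp_less by force
    qed
    then show "\<exists>n. \<forall>x\<in>S n. \<forall>y\<in>S n. dist x y < e"
      by blast
  qed blast
  have "p \<in> K"
    using p[of 0] by (simp add: S_def)
  have "(norm p)\<^sup>2 \<le> m"
  proof (rule field_le_epsilon)
    fix e :: real
    assume "e > 0"
    then obtain n where "1 / Suc n < e"
      using nat_approx_posE by blast
    then show "(norm p)\<^sup>2 \<le> m + e"
      using p[of n] by (simp add: S_def)
  qed
  show ?thesis
  proof (rule ex1I[of _ p])
    show "p \<in> K \<and> (\<forall>y\<in>K. norm p \<le> norm y)"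
      using \<open>p \<in> K\<close> \<open>(norm p)\<^sup>2 \<le> m\<close> m_le
      by (meson norm_ge_zero order_trans power2_le_imp_le)
  next
    fix q
    assume q: "q \<in> K \<and> (\<forall>y\<in>K. norm q \<le> norm y)"
    then have "(norm q)\<^sup>2 \<le> (norm p)\<^sup>2"
      using \<open>p \<in> K\<close> by (simp add: power_mono)
    then have "(norm q)\<^sup>2 \<le> m"
      using \<open>(norm p)\<^sup>2 \<le> m\<close> by (rule order_trans)
    then have "2 * ((norm p)\<^sup>2 - m) + 2 * ((norm q)\<^sup>2 - m) \<le> 0"
      using \<open>(norm p)\<^sup>2 \<le> m\<close> by (intro add_nonpos_nonpos) auto
    then have "(dist p q)\<^sup>2 \<le> 0"
      using dist_le[of p q] q \<open>p \<in> K\<close> order_trans by blast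
    then show "q = p"
      by simp
  qed
qed

text \<open>
  Orthogonality to a complex subspace is thus orthogonality for the real inner product,
  and the real theory of convex sets applies.
\<close>

lemma cinner_eq_Complex:
  fixes x y :: "'h::complex_inner"
  shows "cinner x y = Complex (inner x y) (inner x (\<i> *\<^sub>C y))"
proof -
  have "cinner x (\<i> *\<^sub>C y) = cnj (\<i> * cinner y x)"
    by (metis cinner_commute cinner_scaleC_left)
  also have "\<dots> = - \<i> * cinner x y"
    by (metis cinner_commute complex_cnj_i complex_cnj_mult)
  finally show ?thesis
    by (simp add: complex_eq_iff inner_eq_Re_cinner)
qed

lemma unitary_op_props:
  assumes "unitary_op U"
  shows unitary_op_linear: "linear U"
    and unitary_op_scaleC: "U (c *\<^sub>C x) = c *\<^sub>C U x"
    and unitary_op_inner: "inner (U x) (U y) = inner x y"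
    and unitary_op_norm: "norm (U x) = norm x"
proof -
  show "linear U"
  proof
    fix t x y
    show "U (x + y) = U x + U y"
      using assms by (simp add: unitary_op_def)
    show "U (t *\<^sub>R x) = t *\<^sub>R U x"
      using assms by (metis scaleC_of_real unitary_op_def)
  qed
  show "U (c *\<^sub>C x) = c *\<^sub>C U x" and *: "inner (U x) (U y) = inner x y" for y
    using assms by (simp_all add: unitary_op_def inner_eq_Re_cinner)
  show "norm (U x) = norm x"
    by (simp add: norm_eq_sqrt_inner *)
qed

locale unitary_hom = group G for G (structure) +
  fixes \<pi> :: "'g \<Rightarrow> 'h::chilbert_space \<Rightarrow> 'h"
  assumes hom: "\<pi> \<in> hom G unitary_group"
begin

lemma unitary [simp]: "g \<in> carrier G \<Longrightarrow> unitary_op (\<pi> g)"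
  using hom by (auto simp: hom_def unitary_group_def)

lemma rep_linear: "g \<in> carrier G \<Longrightarrow> linear (\<pi> g)"
  by (simp add: unitary_op_linear)

lemma rep_norm [simp]: "g \<in> carrier G \<Longrightarrow> norm (\<pi> g x) = norm x"
  by (simp add: unitary_op_norm)

lemma rep_dist [simp]: "g \<in> carrier G \<Longrightarrow> dist (\<pi> g x) (\<pi> g y) = dist x y"
  by (metis dist_norm linear_diff rep_linear rep_norm)

lemma rep_mult [simp]:
  "g \<in> carrier G \<Longrightarrow> h \<in> carrier G \<Longrightarrow> \<pi> (g \<otimes> h) x = \<pi> g (\<pi> h x)"
  using hom by (simp add: hom_def unitary_group_def)

lemma rep_one [simp]: "\<pi> \<one> x = x"
proof -
  obtain y where "x = \<pi> \<one> y"
    using unitary[OF one_closed] by (meson surjE unitary_op_def)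
  then show ?thesis
    by (metis l_one one_closed rep_mult)
qed

lemma rep_inv [simp]: "g \<in> carrier G \<Longrightarrow> \<pi> (inv g) (\<pi> g x) = x"
  by (metis inv_closed l_inv rep_mult rep_one)

definition invariants :: "'g set \<Rightarrow> 'h set" where
  "invariants H = {x. \<forall>g\<in>H. \<pi> g x = x}"

lemma subspace_invariants:
  assumes "H \<subseteq> carrier G"
  shows "subspace (invariants H)"
proof -
  have "linear (\<pi> g)" if "g \<in> H" for g
    using assms that by (auto simp: rep_linear)
  then show ?thesis
    by (auto simp: invariants_def linear_add linear_scale linear_0 intro!: subspaceI)
qed

text \<open>
  Multiplication by \<open>\<i>\<close> preserves the invariants, which is why the real inner product suffices
  to recognize the projection.
\<close>

lemma orth_proj_invariants_eqI:
  assumes "H \<subseteq> carrier G" and "p \<in> invariants H"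
    and "\<And>s. s \<in> invariants H \<Longrightarrow> inner (x - p) s = 0"
  shows "orth_proj (invariants H) x = p"
  unfolding orth_proj_def
proof (rule the_equality)
  have "\<i> *\<^sub>C s \<in> invariants H" if "s \<in> invariants H" for s
    using that assms(1) by (auto simp: invariants_def unitary_op_scaleC subset_iff)
  then have "cinner (x - p) s = 0" if "s \<in> invariants H" for s
    using that assms(3) by (simp add: cinner_eq_Complex complex_eq_iff)
  then show "p \<in> invariants H \<and> (\<forall>s\<in>invariants H. cinner (x - p) s = 0)"
    using assms(2) by blast
next
  fix q
  assume q: "q \<in> invariants H \<and> (\<forall>s\<in>invariants H. cinner (x - q) s = 0)"
  let ?s = "q - p"
  have "?s \<in> invariants H"
    using q assms(2) subspace_invariants[OF assms(1)] by (simp add: subspace_diff)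
  then have "inner (x - p) ?s = 0" "inner (x - q) ?s = 0"
    using q assms(3) by (simp_all add: inner_eq_Re_cinner)
  then have "inner ?s ?s = 0"
    by (simp add: inner_diff_left)
  then show "q = p"
    by simp
qed

text \<open>
  This is the mean ergodic theorem of Alaoglu and Birkhoff. The subgroup \<open>H\<close> acts on the closed convex hull
  of the orbit by isometries, so the unique point of minimal norm of the hull is invariant.
  An invariant vector has the same inner product with every point of the orbit, hence with
  every point of the hull, which makes that minimal point the orthogonal projection of \<open>x\<close>.
\<close>

lemma invariant_in_orbit_hull:
  assumes "subgroup H G"
  obtains p where "p \<in> invariants H"
    and "p \<in> closure (convex hull ((\<lambda>g. \<pi> g x) ` H))"
    and "\<And>s. s \<in> invariants H \<Longrightarrow> inner (x - p) s = 0"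
proof -
  interpret H: subgroup H G by fact
  let ?O = "(\<lambda>g. \<pi> g x) ` H"
  let ?K = "closure (convex hull ?O)"
  have K_least: "?K \<subseteq> C" if "closed C" "convex C" "\<And>g. g \<in> H \<Longrightarrow> \<pi> g x \<in> C" for C
    using that by (intro closure_minimal hull_minimal) auto
  have "H \<noteq> {}"
    using H.one_closed by blast
  then have "?K \<noteq> {}"
    by simp
  then have "\<exists>!p. p \<in> ?K \<and> (\<forall>y\<in>?K. norm p \<le> norm y)"
    by (intro closed_convex_minimal_norm closed_closure convex_closure convex_convex_hull)
  then obtain p where p: "p \<in> ?K" "\<forall>y\<in>?K. norm p \<le> norm y"
    and unique: "\<And>q. q \<in> ?K \<and> (\<forall>y\<in>?K. norm q \<le> norm y) \<Longrightarrow> q = p"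
    by (elim ex1E) blast
  have "\<pi> g p = p" if "g \<in> H" for g
  proof -
    have g: "g \<in> carrier G"
      using that H.subset by auto
    have lin: "bounded_linear (\<pi> g)"
      using rep_linear[OF g] g by (intro bounded_linear_intro[of _ 1]) (simp_all add: linear_add linear_scale)
    have "?K \<subseteq> \<pi> g -` ?K"
    proof (rule K_least)
      show "closed (\<pi> g -` ?K)"
        using linear_continuous_on[OF lin, of UNIV] by (intro closed_vimage closed_closure)
      show "convex (\<pi> g -` ?K)"
        by (intro convex_linear_vimage rep_linear g convex_closure convex_convex_hull)
      fix h
      assume "h \<in> H"
      then have "\<pi> (g \<otimes> h) x \<in> ?O"
        using \<open>g \<in> H\<close> by blast
      then have "\<pi> (g \<otimes> h) x \<in> ?K"
        by (meson closure_subset hull_inc subsetD)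
      then show "\<pi> h x \<in> \<pi> g -` ?K"
        using rep_mult[OF g H.mem_carrier[OF \<open>h \<in> H\<close>]] by simp
    qed
    then have "\<pi> g p \<in> ?K \<and> (\<forall>y\<in>?K. norm (\<pi> g p) \<le> norm y)"
      using p g by auto
    then show ?thesis
      by (rule unique)
  qed
  then have inv: "p \<in> invariants H"
    by (simp add: invariants_def)
  have "inner (x - p) s = 0" if s: "s \<in> invariants H" for s
  proof -
    have "?K \<subseteq> {y. inner s y = inner s x}"
    proof (rule K_least)
      fix g
      assume "g \<in> H"
      then have "inner (\<pi> g s) (\<pi> g x) = inner s x"
        by (simp add: unitary_op_inner)
      moreover have "\<pi> g s = s"
        using s \<open>g \<in> H\<close> by (simp add: invariants_def)
      ultimately show "\<pi> g x \<in> {y. inner s y = inner s x}"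
        by simp
    qed (auto simp: closed_hyperplane convex_hyperplane)
    then show ?thesis
      using p(1) by (auto simp: inner_diff_right inner_commute[of _ s])
  qed
  with inv p(1) that show ?thesis
    by blast
qed

end


section \<open>Isometry groups\<close>

lemma carrier_isom_group_iff:
  "g \<in> carrier (isom_group M d) \<longleftrightarrow> g \<in> Bij M \<and> (\<forall>x\<in>M. \<forall>y\<in>M. d (g x) (g y) = d x y)"
  by (auto simp: isom_group_def surj_isometry_def Bij_def bij_betw_def)

lemma isom_group_apply:
  assumes "g \<in> carrier (isom_group M d)"
  shows isom_group_closed: "x \<in> M \<Longrightarrow> g x \<in> M"
    and isom_group_dist: "x \<in> M \<Longrightarrow> y \<in> M \<Longrightarrow> d (g x) (g y) = d x y"
  using assms Bij_imp_funcset by (auto simp: carrier_isom_group_iff)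

lemma isom_group_mult_apply:
  assumes "g \<in> carrier (isom_group M d)" "h \<in> carrier (isom_group M d)" "x \<in> M"
  shows "(g \<otimes>\<^bsub>isom_group M d\<^esub> h) x = g (h x)"
  using assms by (simp add: isom_group_def BijGroup_def compose_def)

lemma isom_group_one_apply: "x \<in> M \<Longrightarrow> \<one>\<^bsub>isom_group M d\<^esub> x = x"
  by (simp add: isom_group_def BijGroup_def)

lemma group_isom_group: "group (isom_group M d)"
proof -
  let ?I = "{g \<in> Bij M. surj_isometry M d M d g}"
  have I_iff: "g \<in> ?I \<longleftrightarrow> g \<in> Bij M \<and> (\<forall>x\<in>M. \<forall>y\<in>M. d (g x) (g y) = d x y)" for g
    using carrier_isom_group_iff[of g M d] by (simp add: isom_group_def)
  have "subgroup ?I (BijGroup M)"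
  proof (rule group.subgroupI[OF group_BijGroup])
    show "?I \<subseteq> carrier (BijGroup M)"
      by (auto simp: BijGroup_def)
    have "(\<lambda>x\<in>M. x) \<in> ?I"
      by (subst I_iff) (simp add: id_Bij)
    then show "?I \<noteq> {}"
      by blast
  next
    fix g
    assume g: "g \<in> ?I"
    have inv_into: "inv_into M g x \<in> M" "g (inv_into M g x) = x" if "x \<in> M" for x
      using that g by (auto simp: Bij_def bij_betw_def inv_into_into f_inv_into_f)
    have "d (inv_into M g x) (inv_into M g y) = d x y" if "x \<in> M" "y \<in> M" for x y
    proof -
      have "d (g (inv_into M g x)) (g (inv_into M g y)) = d (inv_into M g x) (inv_into M g y)"
        using g that inv_into(1) unfolding I_iff by blast
      then show ?thesis
        by (simp add: inv_into(2) that)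
    qed
    then show "inv\<^bsub>BijGroup M\<^esub> g \<in> ?I"
      using g by (subst I_iff) (simp add: inv_BijGroup restrict_inv_into_Bij)
  next
    fix g h
    assume "g \<in> ?I" "h \<in> ?I"
    then have gh: "g \<in> Bij M" "h \<in> Bij M" "\<forall>x\<in>M. \<forall>y\<in>M. d (g x) (g y) = d x y"
      "\<forall>x\<in>M. \<forall>y\<in>M. d (h x) (h y) = d x y"
      unfolding I_iff by blast+
    have "h x \<in> M" if "x \<in> M" for x
      using Bij_imp_funcset[OF gh(2)] that by auto
    then have "compose M g h \<in> ?I"
      unfolding I_iff using gh by (simp add: compose_Bij compose_eq)
    then show "g \<otimes>\<^bsub>BijGroup M\<^esub> h \<in> ?I"
      using gh by (simp add: BijGroup_def)
  qed
  then show ?thesis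
    unfolding isom_group_def by (rule subgroup.subgroup_is_group[OF _ group_BijGroup])
qed

lemma isom_group_inv_apply:
  assumes g: "g \<in> carrier (isom_group M d)" and "x \<in> M"
  shows "(inv\<^bsub>isom_group M d\<^esub> g) (g x) = x" and "g ((inv\<^bsub>isom_group M d\<^esub> g) x) = x"
proof -
  interpret group "isom_group M d" by (rule group_isom_group)
  show "(inv\<^bsub>isom_group M d\<^esub> g) (g x) = x" "g ((inv\<^bsub>isom_group M d\<^esub> g) x) = x"
    using assms isom_group_mult_apply[of "inv\<^bsub>isom_group M d\<^esub> g" M d g x]
      isom_group_mult_apply[of g M d "inv\<^bsub>isom_group M d\<^esub> g" x]
    by (simp_all add: isom_group_one_apply)
qed

lemma subgroup_pointwise_stabilizer:
  assumes "A \<subseteq> M"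
  shows "subgroup (pointwise_stabilizer (isom_group M d) A) (isom_group M d)"
proof -
  interpret group "isom_group M d" by (rule group_isom_group)
  show ?thesis
  proof (rule subgroupI)
    show "pointwise_stabilizer (isom_group M d) A \<noteq> {}"
      using assms by (auto simp: pointwise_stabilizer_def subset_iff isom_group_one_apply
          intro!: exI[of _ "\<one>\<^bsub>isom_group M d\<^esub>"])
  next
    fix g
    assume "g \<in> pointwise_stabilizer (isom_group M d) A"
    then show "inv\<^bsub>isom_group M d\<^esub> g \<in> pointwise_stabilizer (isom_group M d) A"
      using assms by (simp add: pointwise_stabilizer_def) (metis isom_group_inv_apply(1) subsetD)
  next
    fix g h
    assume "g \<in> pointwise_stabilizer (isom_group M d) A"
      "h \<in> pointwise_stabilizer (isom_group M d) A"
    then show "g \<otimes>\<^bsub>isom_group M d\<^esub> h \<in> pointwise_stabilizer (isom_group M d) A"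
      using assms by (auto simp: pointwise_stabilizer_def isom_group_mult_apply subset_iff)
  qed (auto simp: pointwise_stabilizer_def)
qed


section \<open>One-point extensions in the limit\<close>

text \<open>
  Points can be added to finite subsets of the limit: universality gives a copy of the extended
  space somewhere in \<open>\<Omega>\<close>, and homogeneity moves it onto the given points.
\<close>

locale simplex_free_limit =
  fixes r :: nat and \<Omega> :: "'a set" and d :: "'a \<Rightarrow> 'a \<Rightarrow> real"
  assumes limit: "is_simplex_free_limit r \<Omega> d"
begin

lemma free: "simplex_free_space r \<Omega> d"
  using limit by (simp add: is_simplex_free_limit_def)

lemma metric: "Metric_space \<Omega> d"
  using free by (simp add: simplex_free_space_def integral_metric_space_def)

lemma dist_Nats: "x \<in> \<Omega> \<Longrightarrow> y \<in> \<Omega> \<Longrightarrow> d x y \<in> \<nat>"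
  using free by (simp add: simplex_free_space_def integral_metric_space_def)

lemma dist_ge_1:
  assumes "x \<in> \<Omega>" "y \<in> \<Omega>" "x \<noteq> y"
  shows "1 \<le> d x y"
proof -
  obtain n :: nat where "d x y = n"
    using dist_Nats assms Nats_cases by blast
  moreover have "d x y \<noteq> 0"
    using Metric_space.zero[OF metric] assms by simp
  ultimately show ?thesis
    by simp
qed

lemma homogeneous:
  assumes "finite A" "A \<subseteq> \<Omega>" "f ` A \<subseteq> \<Omega>"
    and "\<And>x y. x \<in> A \<Longrightarrow> y \<in> A \<Longrightarrow> d (f x) (f y) = d x y"
  obtains g where "g \<in> carrier (isom_group \<Omega> d)" "\<And>x. x \<in> A \<Longrightarrow> g x = f x"
proof -
  have "metrically_homogeneous \<Omega> d"
    using limit by (simp add: is_simplex_free_limit_def)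
  moreover have "surj_isometry A d (f ` A) d f"
    using assms(4) by (simp add: surj_isometry_def)
  ultimately show ?thesis
    using that assms(1-3) by (metis finite_imageI metrically_homogeneous_def)
qed

text \<open>
  Homogeneity extends the map that fixes \<open>A\<close> and sends \<open>b\<close> to \<open>z\<close>. It is well defined for
  \<open>b \<in> A\<close> as well, since then \<open>d z b = 0\<close>.
\<close>

lemma homogeneous_insert:
  assumes "finite A" "A \<subseteq> \<Omega>" "b \<in> \<Omega>" "z \<in> \<Omega>" "\<And>x. x \<in> A \<Longrightarrow> d z x = d b x"
  obtains g where "g \<in> pointwise_stabilizer (isom_group \<Omega> d) A" "g b = z"
proof -
  interpret Metric_space \<Omega> d by (rule metric)
  let ?f = "\<lambda>x. if x = b then z else x"
  have zA: "b \<in> A \<Longrightarrow> z = b"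
    using assms by (metis zero)
  have Az: "d x z = d x b" if "x \<in> A" for x
    using assms(5)[OF that] by (simp add: commute)
  obtain g where g: "g \<in> carrier (isom_group \<Omega> d)" "\<And>x. x \<in> insert b A \<Longrightarrow> g x = ?f x"
  proof (rule homogeneous[of "insert b A" ?f])
    fix x y
    assume "x \<in> insert b A" "y \<in> insert b A"
    then show "d (?f x) (?f y) = d x y"
      using assms(3-5) zA Az by auto
  qed (use assms in auto)
  moreover have "g x = x" if "x \<in> A" for x
    using g(2)[of x] that zA by (auto split: if_splits)
  ultimately show ?thesis
    using that[of g] by (auto simp: pointwise_stabilizer_def)
qed

text \<open>
  The defining property of the limit mentions spaces of natural numbers only; other carriers are
  transported along an injection into the natural numbers.
\<close>

lemma universal:
  fixes F :: "'b set"
  assumes "finite F" and F: "simplex_free_space r F e"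
  obtains f where "f ` F \<subseteq> \<Omega>" "\<And>x y. x \<in> F \<Longrightarrow> y \<in> F \<Longrightarrow> d (f x) (f y) = e x y"
proof -
  obtain i :: "'b \<Rightarrow> nat" where i: "inj_on i F"
    using finite_imp_inj_to_nat_seg[OF \<open>finite F\<close>] by blast
  define j where "j = inv_into F i"
  let ?e = "\<lambda>m n. e (j m) (j n)"
  interpret F: Metric_space F e
    using F by (simp add: simplex_free_space_def integral_metric_space_def)
  have j_in: "j m \<in> F" if "m \<in> i ` F" for m
    using that by (simp add: j_def inv_into_into)
  have inj_j: "inj_on j (i ` F)"
    unfolding j_def by (rule inj_on_inv_into) simp
  have "simplex_free_space r (i ` F) ?e"
    unfolding simplex_free_space_def integral_metric_space_def
  proof (intro conjI ballI notI)
    show "Metric_space (i ` F) ?e"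
    proof
      fix m n
      assume "m \<in> i ` F" "n \<in> i ` F"
      then show "?e m n = 0 \<longleftrightarrow> m = n"
        using j_in inj_j by (metis F.zero inj_onD)
    qed (use j_in in \<open>auto simp: F.commute F.triangle\<close>)
    fix m n
    assume "m \<in> i ` F" "n \<in> i ` F"
    then show "?e m n \<in> \<nat>"
      using j_in F by (simp add: simplex_free_space_def integral_metric_space_def)
  next
    assume "\<exists>S. unit_simplex (i ` F) ?e (r - 1) S"
    then obtain S where S: "S \<subseteq> i ` F" "finite S" "card S = r - 1 + 1"
      "pairwise (\<lambda>m n. ?e m n = 1) S"
      by (auto simp: unit_simplex_def)
    have "card (j ` S) = card S"
      using S(1) inj_j by (meson card_image inj_on_subset)
    then have "unit_simplex F e (r - 1) (j ` S)"
      using S j_in by (auto simp: unit_simplex_def pairwise_def)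
    then show False
      using F by (auto simp: simplex_free_space_def)
  qed
  then obtain N f where "N \<subseteq> \<Omega>" "surj_isometry (i ` F) ?e N d f"
    using limit \<open>finite F\<close> unfolding is_simplex_free_limit_def by (meson finite_imageI)
  then show ?thesis
    using i that[of "f \<circ> i"] by (auto simp: surj_isometry_def j_def)
qed

text \<open>
  The one-point extension property. The bounds on \<open>\<phi>\<close> are the triangle inequalities of
  the extended space (\<open>\<phi>\<close> is a Katetov function). The point \<open>b\<close> excludes unit simplices:
  replacing the new point by \<open>b\<close> turns a unit simplex of the extended space into one of \<open>\<Omega>\<close>.
\<close>

lemma one_point_extension:
  assumes "finite P" "P \<subseteq> \<Omega>"
    and \<phi>_Nats: "\<And>x. x \<in> P \<Longrightarrow> \<phi> x \<in> \<nat>"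
    and \<phi>_pos: "\<And>x. x \<in> P \<Longrightarrow> 1 \<le> \<phi> x"
    and \<phi>_lower: "\<And>x y. x \<in> P \<Longrightarrow> y \<in> P \<Longrightarrow> \<phi> x \<le> d x y + \<phi> y"
    and \<phi>_upper: "\<And>x y. x \<in> P \<Longrightarrow> y \<in> P \<Longrightarrow> d x y \<le> \<phi> x + \<phi> y"
    and b: "b \<in> \<Omega>" "\<And>x. x \<in> P \<Longrightarrow> \<phi> x = 1 \<Longrightarrow> d b x = 1"
  obtains z where "z \<in> \<Omega>" "\<And>x. x \<in> P \<Longrightarrow> d z x = \<phi> x"
proof -
  interpret Metric_space \<Omega> d by (rule metric)
  \<comment> \<open>The new point is \<^const>\<open>None\<close>. The absolute value makes \<open>e\<close> nonnegative outside \<open>P\<close> too.\<close>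
  define e where "e u v = (case (u, v) of
      (None, None) \<Rightarrow> 0 | (Some x, None) \<Rightarrow> \<bar>\<phi> x\<bar> | (None, Some y) \<Rightarrow> \<bar>\<phi> y\<bar> | (Some x, Some y) \<Rightarrow> d x y)"
    for u v
  have [simp]: "e None None = 0" "e (Some x) None = \<bar>\<phi> x\<bar>" "e None (Some y) = \<bar>\<phi> y\<bar>"
    "e (Some x) (Some y) = d x y" for x y
    by (simp_all add: e_def)
  let ?Z = "insert None (Some ` P)"
  have \<phi>_abs [simp]: "\<bar>\<phi> x\<bar> = \<phi> x" if "x \<in> P" for x
    using \<phi>_pos[OF that] by simp
  have \<phi>_nonneg: "0 \<le> \<phi> x" if "x \<in> P" for x
    using \<phi>_pos[OF that] by simp
  have \<phi>_lower': "\<phi> y \<le> \<phi> x + d x y" if "x \<in> P" "y \<in> P" for x y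
    using \<phi>_lower[OF that(2,1)] by (simp add: commute)
  have "simplex_free_space r ?Z e"
    unfolding simplex_free_space_def integral_metric_space_def
  proof (intro conjI ballI notI)
    show "Metric_space ?Z e"
    proof
      fix u v
      show "0 \<le> e u v"
        by (cases u; cases v) simp_all
      show "e u v = e v u"
        by (cases u; cases v) (simp_all add: commute)
      assume "u \<in> ?Z" "v \<in> ?Z"
      then show "e u v = 0 \<longleftrightarrow> u = v"
        using \<phi>_pos \<open>P \<subseteq> \<Omega>\<close> by (force simp: subset_iff)
    next
      fix u v w
      assume "u \<in> ?Z" "v \<in> ?Z" "w \<in> ?Z"
      then show "e u w \<le> e u v + e v w"
        using \<phi>_nonneg \<phi>_lower \<phi>_lower' \<phi>_upper triangle \<open>P \<subseteq> \<Omega>\<close>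
        by (auto simp: subset_iff)
    qed
    fix u v
    assume "u \<in> ?Z" "v \<in> ?Z"
    then show "e u v \<in> \<nat>"
      using \<phi>_Nats dist_Nats \<open>P \<subseteq> \<Omega>\<close> by (auto simp: subset_iff)
  next
    assume "\<exists>S. unit_simplex ?Z e (r - 1) S"
    then obtain S where S: "S \<subseteq> ?Z" "finite S" "card S = r - 1 + 1" "pairwise (\<lambda>u v. e u v = 1) S"
      by (auto simp: unit_simplex_def)
    \<comment> \<open>The new point is replaced by \<open>b\<close>.\<close>
    define q where "q u = (case u of None \<Rightarrow> b | Some x \<Rightarrow> x)" for u
    have q_dist: "d (q u) (q v) = 1" if "u \<in> S" "v \<in> S" "u \<noteq> v" for u v
    proof -
      have "e u v = 1"
        using S(4) that by (simp add: pairwise_def)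
      moreover have "u \<in> ?Z" "v \<in> ?Z"
        using that S(1) by blast+
      moreover have "d x b = 1" if "x \<in> P" "\<phi> x = 1" for x
        using b(2)[OF that] by (simp add: commute)
      ultimately show ?thesis
        using that(3) b(2) by (auto simp: q_def)
    qed
    have "q ` ?Z \<subseteq> \<Omega>"
      using b(1) \<open>P \<subseteq> \<Omega>\<close> by (auto simp: q_def)
    then have q_in: "q ` S \<subseteq> \<Omega>"
      using S(1) by blast
    have "inj_on q S"
    proof (rule inj_onI, rule ccontr)
      fix u v
      assume uv: "u \<in> S" "v \<in> S" "q u = q v" "u \<noteq> v"
      have "q u \<in> \<Omega>"
        using uv(1) q_in by blast
      then show False
        using q_dist[of u v] uv by simp
    qed
    with q_in have "unit_simplex \<Omega> d (r - 1) (q ` S)"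
      using S(2,3) q_dist by (auto simp: unit_simplex_def card_image pairwise_def)
    then show False
      using free by (auto simp: simplex_free_space_def)
  qed
  then obtain f where f: "f ` ?Z \<subseteq> \<Omega>" "\<And>u v. u \<in> ?Z \<Longrightarrow> v \<in> ?Z \<Longrightarrow> d (f u) (f v) = e u v"
    using universal[of ?Z e] \<open>finite P\<close> by blast
  obtain g where g: "g \<in> carrier (isom_group \<Omega> d)" "\<And>x. x \<in> P \<Longrightarrow> g x = f (Some x)"
  proof (rule homogeneous[of P "\<lambda>x. f (Some x)"])
    show "(\<lambda>x. f (Some x)) ` P \<subseteq> \<Omega>"
      using f(1) by blast
    show "d (f (Some x)) (f (Some y)) = d x y" if "x \<in> P" "y \<in> P" for x y
      using f(2)[of "Some x" "Some y"] that by simp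
  qed (use assms(1,2) in auto)
  let ?z = "(inv\<^bsub>isom_group \<Omega> d\<^esub> g) (f None)"
  have inv_g: "inv\<^bsub>isom_group \<Omega> d\<^esub> g \<in> carrier (isom_group \<Omega> d)"
    by (rule group.inv_closed[OF group_isom_group g(1)])
  show ?thesis
  proof (rule that[of ?z])
    show z: "?z \<in> \<Omega>"
      using isom_group_closed[OF inv_g] f(1) by blast
    fix x
    assume x: "x \<in> P"
    then have "d ?z x = d (g ?z) (g x)"
      using isom_group_dist[OF g(1) z] \<open>P \<subseteq> \<Omega>\<close> by auto
    also have "\<dots> = d (f None) (f (Some x))"
      using isom_group_inv_apply(2)[OF g(1), of "f None"] f(1) g(2) x by simp
    also have "\<dots> = \<phi> x"
      using f(2) x by simp
    finally show "d ?z x = \<phi> x" .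
  qed
qed

text \<open>
  Points of \<open>P\<close> have distance at least \<open>1\<close> to \<open>b\<close>, so a second point may repeat
  all distances of \<open>b\<close> to \<open>P\<close> and have distance \<open>2\<close> to \<open>b\<close> itself.
\<close>

lemma twin_point:
  assumes "finite P" "P \<subseteq> \<Omega>" "b \<in> \<Omega>" "b \<notin> P"
  obtains z where "z \<in> \<Omega>" "d b z = 2" "\<And>x. x \<in> P \<Longrightarrow> d z x = d b x"
proof -
  interpret Metric_space \<Omega> d by (rule metric)
  let ?\<phi> = "\<lambda>x. if x = b then 2 else d b x"
  have P: "x \<in> \<Omega>" "x \<noteq> b" "1 \<le> d b x" "d b x \<in> \<nat>" if "x \<in> P" for x
    using that assms dist_ge_1[of b x] dist_Nats by auto
  obtain z where "z \<in> \<Omega>" "\<And>x. x \<in> insert b P \<Longrightarrow> d z x = ?\<phi> x"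
  proof (rule one_point_extension[of "insert b P" ?\<phi> b])
    fix x y
    assume xy: "x \<in> insert b P" "y \<in> insert b P"
    show "?\<phi> x \<le> d x y + ?\<phi> y"
      using xy P(1-3)[of x] P(1-3)[of y] \<open>b \<in> \<Omega>\<close> triangle[of b y x]
      by (auto simp: commute[of y x] commute[of x b])
    show "d x y \<le> ?\<phi> x + ?\<phi> y"
      using xy P(1-3)[of x] P(1-3)[of y] \<open>b \<in> \<Omega>\<close> triangle[of x b y]
      by (auto simp: commute[of x b])
  qed (use assms P in \<open>auto split: if_splits\<close>)
  then show ?thesis
    using that[of z] P by (metis commute insertCI)
qed

text \<open>
  A first step of length \<open>2\<close> from \<open>b\<close> towards \<open>y\<close> that keeps the distances to \<open>D\<close>, with
  remaining distance \<open>m\<close>. Two of the bounds on \<open>m\<close> are triangle inequalities for \<open>b\<close>, \<open>y\<close> and the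
  new point. The last one gives \<open>m \<le> 2 * d b x\<close> for \<open>x \<in> D\<close>, since both \<open>2\<close> and
  \<open>d b y\<close> are at most \<open>2 * d b x\<close>. The new point is at distance at least \<open>2\<close> from both \<open>b\<close> and \<open>y\<close>, so it
  creates no unit simplex.
\<close>

lemma intermediate_point:
  assumes "finite D" "D \<subseteq> \<Omega>" "b \<in> \<Omega>" "b \<notin> D" "y \<in> \<Omega>" and y: "\<And>x. x \<in> D \<Longrightarrow> d y x = d b x"
    and m: "m \<in> \<nat>" "2 \<le> m" "m \<le> d b y + 2" "d b y \<le> m + 2" "y \<noteq> b" "m \<le> 2 \<or> m \<le> d b y"
  obtains z where "z \<in> \<Omega>" "d b z = 2" "d z y = m" "\<And>x. x \<in> D \<Longrightarrow> d z x = d b x"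
proof -
  interpret Metric_space \<Omega> d by (rule metric)
  define \<phi> where "\<phi> x = (if x = b then 2 else if x = y then m else d b x)" for x
  have D: "x \<in> \<Omega>" "x \<noteq> b" "x \<noteq> y" "1 \<le> d b x" "d b x \<in> \<nat>" "m \<le> d b x + d b x"
    if "x \<in> D" for x
  proof -
    show x: "x \<in> \<Omega>" "x \<noteq> b" "1 \<le> d b x" "d b x \<in> \<nat>"
      using that assms dist_ge_1[of b x] dist_Nats by auto
    have "d b y \<le> d b x + d b x"
      using triangle[of b x y] x assms(3,5) y[OF that] by (simp add: commute)
    then show "m \<le> d b x + d b x"
      using x(3) m(6) by linarith
    show "x \<noteq> y"
      using x y[OF that] assms(5) by auto
  qed
  have D2: "d x x' \<le> d b x + d b x'" "d b x \<le> d x x' + d b x'" if "x \<in> D" "x' \<in> D" for x x'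
    using triangle[of x b x'] triangle[of b x' x] D(1)[OF that(1)] D(1)[OF that(2)] \<open>b \<in> \<Omega>\<close>
    by (simp_all add: commute[of x b] commute[of x' x])
  have sym: "d y b = d b y" "x \<in> D \<Longrightarrow> d x b = d b x" "x \<in> D \<Longrightarrow> d x y = d b x" for x
    using y by (simp_all add: commute)
  have \<phi>: "\<phi> b = 2" "\<phi> y = m" "x \<in> D \<Longrightarrow> \<phi> x = d b x" for x
    using D(2,3) m(5) by (auto simp: \<phi>_def)
  obtain z where "z \<in> \<Omega>" "\<And>x. x \<in> insert b (insert y D) \<Longrightarrow> d z x = \<phi> x"
  proof (rule one_point_extension[of "insert b (insert y D)" \<phi> b])
    fix x x'
    assume x: "x \<in> insert b (insert y D)" "x' \<in> insert b (insert y D)"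
    then consider "x \<in> {b, y}" "x' \<in> {b, y}" | "x \<in> D" "x' \<in> {b, y}" | "x \<in> {b, y}" "x' \<in> D"
      | "x \<in> D" "x' \<in> D"
      by blast
    then have "\<phi> x \<le> d x x' + \<phi> x' \<and> d x x' \<le> \<phi> x + \<phi> x'"
    proof cases
      case 1
      then show ?thesis
        using m assms(3,5) by (auto simp: \<phi> sym)
    next
      case 2
      then show ?thesis
        using m D(4)[of x] by (auto simp: \<phi> sym)
    next
      case 3
      then show ?thesis
        using m y[of x'] D(4,6)[of x'] by (auto simp: \<phi>)
    next
      case 4
      then show ?thesis
        using D2 by (simp add: \<phi>)
    qed
    then show "\<phi> x \<le> d x x' + \<phi> x'" "d x x' \<le> \<phi> x + \<phi> x'"
      by blast+
  next
    fix x
    assume x: "x \<in> insert b (insert y D)"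
    then show "\<phi> x \<in> \<nat>" "1 \<le> \<phi> x" "\<phi> x = 1 \<Longrightarrow> d b x = 1"
      using D(4,5) m(1,2) by (auto simp: \<phi>)
  qed (use assms in auto)
  then show ?thesis
    using that[of z] \<phi> commute by simp
qed

end


section \<open>Forgetting one point of the support\<close>

locale simplex_free_limit_rep = simplex_free_limit r \<Omega> d for r and \<Omega> :: "'a set" and d +
  fixes \<pi> :: "('a \<Rightarrow> 'a) \<Rightarrow> 'h::chilbert_space \<Rightarrow> 'h"
  assumes rep_hom: "\<pi> \<in> hom (isom_group \<Omega> d) unitary_group"
begin

abbreviation G :: "('a \<Rightarrow> 'a) monoid" where
  "G \<equiv> isom_group \<Omega> d"

abbreviation stab :: "'a set \<Rightarrow> ('a \<Rightarrow> 'a) set" where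
  "stab \<equiv> pointwise_stabilizer G"

abbreviation \<H> :: "'a set \<Rightarrow> 'h set" where
  "\<H> \<equiv> fixed_vectors G \<pi>"

sublocale unitary_hom G \<pi>
  using rep_hom group_isom_group by (simp add: unitary_hom_def unitary_hom_axioms_def)

lemma fixed_vectors_eq: "\<H> A = invariants (stab A)"
  by (simp add: fixed_vectors_def invariants_def)

lemma fixed_vectorsD: "v \<in> \<H> A \<Longrightarrow> g \<in> stab A \<Longrightarrow> \<pi> g v = v"
  by (simp add: fixed_vectors_def)

lemma stab_carrier: "g \<in> stab A \<Longrightarrow> g \<in> carrier G"
  by (simp add: pointwise_stabilizer_def)

lemma subspace_fixed_vectors: "subspace (\<H> A)"
  unfolding fixed_vectors_eq by (rule subspace_invariants) (auto simp: stab_carrier)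

lemma fixed_vectors_mono: "A \<subseteq> B \<Longrightarrow> \<H> A \<subseteq> \<H> B"
  by (auto simp: fixed_vectors_def pointwise_stabilizer_def)

lemma fixed_vectors_translate:
  assumes "g \<in> carrier G" "A \<subseteq> \<Omega>" "v \<in> \<H> A"
  shows "\<pi> g v \<in> \<H> (g ` A)"
  unfolding fixed_vectors_def
proof (intro CollectI ballI)
  fix h
  assume h: "h \<in> stab (g ` A)"
  let ?k = "inv\<^bsub>G\<^esub> g \<otimes>\<^bsub>G\<^esub> (h \<otimes>\<^bsub>G\<^esub> g)"
  have hg: "h \<in> carrier G" "h \<otimes>\<^bsub>G\<^esub> g \<in> carrier G"
    using h assms(1) by (simp_all add: stab_carrier)
  have "?k a = a" if "a \<in> A" for a
  proof -
    have "h (g a) = g a"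
      using h that by (simp add: pointwise_stabilizer_def)
    then show ?thesis
      using assms hg that isom_group_inv_apply(1)[OF assms(1)]
      by (simp add: isom_group_mult_apply subset_iff)
  qed
  then have "?k \<in> stab A"
    using assms(1) hg by (simp add: pointwise_stabilizer_def)
  then have "\<pi> ?k v = v"
    by (rule fixed_vectorsD[OF assms(3)])
  then have "\<pi> g (\<pi> ?k v) = \<pi> g v"
    by simp
  moreover have "g \<otimes>\<^bsub>G\<^esub> ?k = h \<otimes>\<^bsub>G\<^esub> g"
    using assms(1) hg by (simp add: m_assoc[symmetric])
  ultimately show "\<pi> h (\<pi> g v) = \<pi> g v"
    using assms(1) hg by (metis inv_closed m_closed rep_mult)
qed

text \<open>
  The set \<open>F\<close> is thought of as a support of the vectors of \<open>\<H> F\<close>. Only finite supports give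
  the one-point extensions something to work with.
\<close>

definition supported_off :: "'a set \<Rightarrow> 'h set" where
  "supported_off E = {v. \<exists>F. finite F \<and> F \<subseteq> \<Omega> \<and> F \<inter> E = {} \<and> v \<in> \<H> F}"

text \<open>
  A vector close to \<open>v\<close> is fixed by some \<open>stab F\<close> with \<open>b \<notin> F\<close>. Moving \<open>b\<close> to a twin \<open>z\<close>
  over \<open>F \<union> D\<close> thus hardly changes \<open>v\<close>. Over \<open>insert b D\<close> the twin has the same distances as
  \<open>h b\<close>, so \<open>z\<close> is carried to \<open>h b\<close> by an isometry that fixes \<open>v\<close>. The set \<open>F\<close> and the
  twin depend on the precision, but the result of the two moves does not.
\<close>

lemma twin_move_fixes:
  assumes D: "finite D" "D \<subseteq> \<Omega>" "b \<in> \<Omega>" "b \<notin> D"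
    and v: "v \<in> \<H> (insert b D)" "v \<in> closure (supported_off {b})"
    and h: "h \<in> stab D" "d b (h b) = 2"
  shows "\<pi> h v = v"
proof -
  interpret \<Omega>: Metric_space \<Omega> d by (rule metric)
  have close: "dist (\<pi> h v) v \<le> 2 * \<epsilon>" if "\<epsilon> > 0" for \<epsilon>
  proof -
    obtain w F where w: "w \<in> \<H> F" "dist w v < \<epsilon>" and F: "finite F" "F \<subseteq> \<Omega>" "b \<notin> F"
      using v(2) \<open>\<epsilon> > 0\<close> unfolding closure_approachable supported_off_def by blast
    have FD: "finite (F \<union> D)" "F \<union> D \<subseteq> \<Omega>" "b \<notin> F \<union> D"
      using F D by auto
    obtain z where z: "z \<in> \<Omega>" "d b z = 2" "\<And>x. x \<in> F \<union> D \<Longrightarrow> d z x = d b x"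
      using twin_point[OF FD(1,2) D(3) FD(3)] by blast
    obtain k where k: "k \<in> stab (F \<union> D)" "k b = z"
      using homogeneous_insert[OF FD(1,2) D(3) z(1) z(3)] by blast
    have hb: "h b \<in> \<Omega>"
      by (rule isom_group_closed[OF stab_carrier[OF h(1)] D(3)])
    have "d (h b) x = d z x" if "x \<in> insert b D" for x
    proof (cases "x = b")
      case True
      then show ?thesis
        using h(2) z(2) by (simp add: \<Omega>.commute[of _ b])
    next
      case False
      then have "x \<in> D" "h x = x"
        using that h(1) by (auto simp: pointwise_stabilizer_def)
      then show ?thesis
        using isom_group_dist[OF stab_carrier[OF h(1)], of b x] D z(3)[of x] by auto
    qed
    then obtain g where g: "g \<in> stab (insert b D)" "g z = h b"
      using homogeneous_insert[of "insert b D" z "h b"] D z(1) hb by auto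
    have carr: "g \<in> carrier G" "k \<in> carrier G" "h \<in> carrier G"
      using g k h by (simp_all add: stab_carrier)
    \<comment> \<open>\<open>h\<close> and \<open>g \<otimes> k\<close> agree on \<open>insert b D\<close>.\<close>
    have "inv\<^bsub>G\<^esub> h \<otimes>\<^bsub>G\<^esub> (g \<otimes>\<^bsub>G\<^esub> k) \<in> stab (insert b D)"
    proof -
      have "(inv\<^bsub>G\<^esub> h \<otimes>\<^bsub>G\<^esub> (g \<otimes>\<^bsub>G\<^esub> k)) x = x" if "x \<in> insert b D" for x
      proof -
        have "g (k x) = h x"
          using that g k h by (auto simp: pointwise_stabilizer_def)
        then show ?thesis
          using that carr D isom_group_inv_apply(1)[OF carr(3)] by (auto simp: isom_group_mult_apply)
      qed
      then show ?thesis
        using carr by (simp add: pointwise_stabilizer_def)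
    qed
    then have "\<pi> (inv\<^bsub>G\<^esub> h) (\<pi> g (\<pi> k v)) = v"
      using fixed_vectorsD[OF v(1)] carr by fastforce
    then have "\<pi> h v = \<pi> g (\<pi> k v)"
      using carr rep_inv[of "inv\<^bsub>G\<^esub> h" "\<pi> g (\<pi> k v)"] by simp
    moreover have "\<pi> g v = v"
      by (rule fixed_vectorsD[OF v(1) g(1)])
    ultimately have "dist (\<pi> h v) v = dist (\<pi> k v) v"
      using rep_dist[OF carr(1)] by metis
    also have "\<dots> \<le> dist (\<pi> k v) (\<pi> k w) + dist (\<pi> k w) v"
      by (rule dist_triangle)
    also have "\<pi> k w = w"
      using w(1) k(1) by (intro fixed_vectorsD[of w F]) (auto simp: pointwise_stabilizer_def)
    also have "dist (\<pi> k v) w + dist w v \<le> 2 * \<epsilon>"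
      using w(2) rep_dist[OF carr(2), of v w] \<open>\<pi> k w = w\<close> by (simp add: dist_commute)
    finally show ?thesis .
  qed
  have "dist (\<pi> h v) v \<le> 0"
  proof (rule field_le_epsilon)
    fix \<epsilon> :: real
    assume "\<epsilon> > 0"
    then show "dist (\<pi> h v) v \<le> 0 + \<epsilon>"
      using close[of "\<epsilon> / 2"] by simp
  qed
  then show ?thesis
    by simp
qed

text \<open>
  Composition of moves of length \<open>2\<close>, organized as an induction on \<open>d b (h b)\<close>.
\<close>

lemma stab_move_fixes:
  assumes D: "finite D" "D \<subseteq> \<Omega>" "b \<in> \<Omega>" "b \<notin> D"
    and v: "v \<in> \<H> (insert b D)" "v \<in> closure (supported_off {b})"
    and h: "h \<in> stab D"
  shows "\<pi> h v = v"
proof -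
  interpret \<Omega>: Metric_space \<Omega> d by (rule metric)
  have hb: "h b \<in> \<Omega>" if "h \<in> stab D" for h
    by (rule isom_group_closed[OF stab_carrier[OF that] D(3)])
  \<comment> \<open>\<open>h = g \<otimes> k\<close>, where \<open>g\<close> moves \<open>b\<close> by \<open>2\<close> and \<open>k\<close> moves it by \<open>m\<close>.\<close>
  have via: "\<pi> h v = v"
    if h: "h \<in> stab D" "h b \<noteq> b" and m: "2 \<le> m" "m \<le> d b (h b) + 2" "d b (h b) \<le> m + 2"
      "m \<le> 2 \<or> m \<le> d b (h b)"
      and IH: "\<And>k. k \<in> stab D \<Longrightarrow> d b (k b) = m \<Longrightarrow> \<pi> k v = v"
    for h and m :: nat
  proof -
    have hx: "d (h b) x = d b x" if "x \<in> D" for x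
      using isom_group_dist[OF stab_carrier[OF h(1)], of b x] that h(1) D
      by (auto simp: pointwise_stabilizer_def)
    obtain z where z: "z \<in> \<Omega>" "d b z = 2" "d z (h b) = m" "\<And>x. x \<in> D \<Longrightarrow> d z x = d b x"
      using intermediate_point[OF D hb[OF h(1)] hx, of "real m"] h(2) m by auto
    obtain g where g: "g \<in> stab D" "g b = z"
      using homogeneous_insert[OF D(1,2,3) z(1,4)] by blast
    have carr: "g \<in> carrier G" "h \<in> carrier G"
      using g h by (simp_all add: stab_carrier)
    let ?k = "inv\<^bsub>G\<^esub> g \<otimes>\<^bsub>G\<^esub> h"
    have k: "?k \<in> stab D"
      using subgroup_pointwise_stabilizer[OF D(2)] g(1) h(1)
      by (simp add: subgroup.m_closed subgroup.m_inv_closed)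
    have "d b (?k b) = d (g b) (g (?k b))"
      using isom_group_dist[OF carr(1) D(3) hb[OF k]] by simp
    also have "g (?k b) = h b"
      using carr D(3) hb[OF h(1)] isom_group_inv_apply(2)[OF carr(1)] by (simp add: isom_group_mult_apply)
    finally have "d b (?k b) = m"
      using g(2) z(3) by simp
    then have "\<pi> ?k v = v"
      by (rule IH[OF k])
    then have "\<pi> h v = \<pi> g v"
      using carr rep_inv[of "inv\<^bsub>G\<^esub> g" "\<pi> h v"] by simp
    also have "\<pi> g v = v"
      using twin_move_fixes[OF D v g(1)] g(2) z(2) by simp
    finally show ?thesis .
  qed
  have far: "\<pi> h v = v" if "2 \<le> n" "h \<in> stab D" "d b (h b) = n" for h and n :: nat
    using that
  proof (induction n arbitrary: h rule: dec_induct)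
    case base
    then show ?case
      using twin_move_fixes[OF D v] by simp
  next
    case (step n)
    have "h b \<noteq> b"
      using step.prems D(3) by auto
    then show ?case
      using step by (intro via[of h n]) auto
  qed
  obtain n :: nat where n: "d b (h b) = n"
    using dist_Nats[OF D(3) hb[OF h]] Nats_cases by blast
  consider "n = 0" | "n = 1" | "2 \<le> n"
    by linarith
  then show ?thesis
  proof cases
    case 1
    then have "h \<in> stab (insert b D)"
      using n h hb[OF h] D(3) by (simp add: pointwise_stabilizer_def)
    then show ?thesis
      by (rule fixed_vectorsD[OF v(1)])
  next
    case 2
    then have "h b \<noteq> b"
      using n D(3) by auto
    then show ?thesis
      using n 2 h far[of 2] by (intro via[of h 2]) auto
  next
    case 3
    then show ?thesis
      using far h n by blast
  qed
qed

lemma forget_points: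
  assumes "finite E" "finite C" "C \<union> E \<subseteq> \<Omega>" "C \<inter> E = {}"
    and "v \<in> \<H> (C \<union> E)" "v \<in> closure (supported_off E)"
  shows "v \<in> \<H> C"
  using assms
proof (induction E rule: finite_induct)
  case empty
  then show ?case
    by simp
next
  case (insert b E)
  have off: "supported_off (insert b E) \<subseteq> supported_off {b}"
    "supported_off (insert b E) \<subseteq> supported_off E"
    unfolding supported_off_def by blast+
  have v: "v \<in> closure (supported_off {b})" "v \<in> closure (supported_off E)"
    using insert.prems(5) off closure_mono by blast+
  have "\<pi> h v = v" if "h \<in> stab (C \<union> E)" for h
    using insert.hyps insert.prems v that by (intro stab_move_fixes[of "C \<union> E" b v]) auto
  then have "v \<in> \<H> (C \<union> E)"
    by (simp add: fixed_vectors_def)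
  then show ?case
    using insert.IH insert.prems v(2) by blast
qed


section \<open>Dissociation\<close>

text \<open>
  The union of two admissible supports is admissible.
\<close>

lemma convex_supported_off: "convex (supported_off E)"
proof (rule convexI)
  fix x y and s t :: real
  assume "x \<in> supported_off E" "y \<in> supported_off E"
  then obtain F F' where F: "x \<in> \<H> F" "finite F" "F \<subseteq> \<Omega>" "F \<inter> E = {}"
    "y \<in> \<H> F'" "finite F'" "F' \<subseteq> \<Omega>" "F' \<inter> E = {}"
    unfolding supported_off_def by blast
  then have "x \<in> \<H> (F \<union> F')" "y \<in> \<H> (F \<union> F')"
    using fixed_vectors_mono[of F "F \<union> F'"] fixed_vectors_mono[of F' "F \<union> F'"] by blast+
  then have "s *\<^sub>R x + t *\<^sub>R y \<in> \<H> (F \<union> F')"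
    using subspace_fixed_vectors by (simp add: subspace_add subspace_scale)
  then show "s *\<^sub>R x + t *\<^sub>R y \<in> supported_off E"
    using F unfolding supported_off_def by (intro CollectI exI[of _ "F \<union> F'"]) auto
qed

lemma dissociated: "dissociated_rep \<Omega> G \<pi>"
  unfolding dissociated_rep_def
proof (intro allI impI ext)
  fix A B x
  assume AB: "finite A \<and> A \<subseteq> \<Omega> \<and> finite B \<and> B \<subseteq> \<Omega>"
  have sub: "stab A' \<subseteq> carrier G" for A'
    by (auto simp: stab_carrier)
  have A: "subgroup (stab A) G" and B: "subgroup (stab B) G"
    using AB by (simp_all add: subgroup_pointwise_stabilizer)
  obtain p where p: "p \<in> \<H> B" "\<And>s. s \<in> \<H> B \<Longrightarrow> inner (x - p) s = 0"
    using invariant_in_orbit_hull[OF B] unfolding fixed_vectors_eq by blast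
  obtain q where q: "q \<in> \<H> A" "q \<in> closure (convex hull ((\<lambda>g. \<pi> g p) ` stab A))"
    "\<And>s. s \<in> \<H> A \<Longrightarrow> inner (p - q) s = 0"
    using invariant_in_orbit_hull[OF A] unfolding fixed_vectors_eq by blast
  have "\<pi> g p \<in> supported_off (A - B)" if g: "g \<in> stab A" for g
  proof -
    have "\<pi> g p \<in> \<H> (g ` B)"
      using fixed_vectors_translate[OF stab_carrier[OF g]] AB p(1) by blast
    moreover have "g ` B \<subseteq> \<Omega>"
      using isom_group_closed[OF stab_carrier[OF g]] AB by auto
    moreover have "g ` B \<inter> (A - B) = {}"
    proof -
      have "g b \<in> B" if "b \<in> B" "g b \<in> A" for b
      proof -
        have "g (g b) = g b" "g b \<in> \<Omega>" "b \<in> \<Omega>"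
          using g that AB by (auto simp: pointwise_stabilizer_def)
        then have "g b = b"
          using isom_group_inv_apply(1)[OF stab_carrier[OF g]] by metis
        then show ?thesis
          using that(1) by simp
      qed
      then show ?thesis
        by auto
    qed
    ultimately show ?thesis
      using AB unfolding supported_off_def by (intro CollectI exI[of _ "g ` B"]) auto
  qed
  then have "convex hull ((\<lambda>g. \<pi> g p) ` stab A) \<subseteq> supported_off (A - B)"
    by (intro hull_minimal convex_supported_off) auto
  then have "q \<in> closure (supported_off (A - B))"
    using q(2) closure_mono by blast
  moreover have "A \<inter> B \<union> (A - B) = A"
    by blast
  ultimately have qAB: "q \<in> \<H> (A \<inter> B)"
    using AB q(1) by (intro forget_points[of "A - B" "A \<inter> B" q]) auto
  have "inner (x - q) s = 0" if "s \<in> \<H> (A \<inter> B)" for s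
  proof -
    have "s \<in> \<H> A" "s \<in> \<H> B"
      using that fixed_vectors_mono by blast+
    then show ?thesis
      using p(2) q(3) inner_add_left[of "x - p" "p - q" s] by simp
  qed
  then have "orth_proj (\<H> (A \<inter> B)) x = q"
    using qAB unfolding fixed_vectors_eq by (intro orth_proj_invariants_eqI sub)
  moreover have "orth_proj (\<H> B) x = p"
    using p unfolding fixed_vectors_eq by (intro orth_proj_invariants_eqI sub)
  moreover have "orth_proj (\<H> A) p = q"
    using q(1,3) unfolding fixed_vectors_eq by (intro orth_proj_invariants_eqI sub)
  ultimately show "(orth_proj (\<H> A) \<circ> orth_proj (\<H> B)) x = orth_proj (\<H> (A \<inter> B)) x"
    by simp
qed

end

theorem theorem5p15:
  fixes r :: nat and \<Omega> :: "'a set" and d :: "'a \<Rightarrow> 'a \<Rightarrow> real"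
  assumes "r \<ge> 3"
    and "is_simplex_free_limit r \<Omega> d"
  shows "dissociated_group TYPE('h::chilbert_space) \<Omega> (isom_group \<Omega> d)"
  unfolding dissociated_group_def
proof (intro allI impI)
  fix \<pi> :: "('a \<Rightarrow> 'a) \<Rightarrow> 'h \<Rightarrow> 'h"
  assume "unitary_rep \<Omega> (isom_group \<Omega> d) \<pi>"
  then interpret simplex_free_limit_rep r \<Omega> d \<pi>
    using assms(2) by unfold_locales (auto simp: unitary_rep_def)
  show "dissociated_rep \<Omega> (isom_group \<Omega> d) \<pi>"
    by (rule dissociated)
qed
end
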